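(* Assume that $Y=m(\mathbf X)+\varepsilon$, where $\varepsilon$ is a centered Gaussian noise with finite variance $\sigma^2$, independent of $\mathbf X$, and $\|m\|_\infty=\sup_{\mathbf x\in[0,1]^d}|m(\mathbf x)|<\infty$. Then, for all integers $M,n\ge1$, $$R(m_{M,n})=R(m_{\infty,n})+\frac1M\,\mathbb{E}_{\mathbf X,\mathcal{D}_n}\Big[\mathbb{V}_\Theta\big[m_n(\mathbf X,\Theta)\big]\Big].$$ In particular, $$0\le R(m_{M,n})-R(m_{\infty,n})\le\frac8M\times\Big(\|m\|_\infty^2+\sigma^2(1+4\log n)\Big).$$
   Context: Data: $\mathcal{D}_n=((\mathbf X_1,Y_1),\dots,(\mathbf X_n,Y_n))$ is a sample of independent $[0,1]^d\times\mathbb{R}$-valued random variables distributed as $(\mathbf X,Y)$ with $\mathbb{E}[Y^2]<\infty$; $\mathbf X$ denotes also a fresh copy independent of $\mathcal D_n$, and $m(\mathbf x)=\mathbb{E}[Y\mid\mathbf X=\mathbf x]$. Random forest: let $\Theta,\Theta_1,\dots,\Theta_M$ be i.i.d. random variables independent of $\mathcal{D}_n$ and $\mathbf X$. For each value $\theta$ of $\Theta$ (and given $\mathcal D_n$) there is a regression tree $\mathcal{T}_n(\theta)$, i.e. a partition of $[0,1]^d$ into finitely many cells that are axis-parallel hyperrectangles, obtained by successive axis-parallel cuts; the construction may depend on $\theta$ and on $\mathcal{D}_n$. Write $\mathbf x\overset{\theta}{\leftrightarrow}\mathbf z$ if $\mathbf x,\mathbf z$ belong to the same cell of $\mathcal{T}_n(\theta)$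 and let $N_n(\mathbf x,\theta)$ be the number of $\mathbf X_i$ in the cell containing $\mathbf x$. The tree estimate is $m_n(\mathbf x,\theta)=\sum_{i=1}^nY_i\,\mathbf 1_{\mathbf x\overset{\theta}{\leftrightarrow}\mathbf X_i}/N_n(\mathbf x,\theta)$ (with $0/0=0$). The finite forest estimate is $m_{M,n}(\mathbf x,\Theta_1,\dots,\Theta_M)=\frac1M\sum_{m=1}^Mm_n(\mathbf x,\Theta_m)$ and the infinite forest estimate is $m_{\infty,n}(\mathbf x)=\mathbb{E}_\Theta[m_n(\mathbf x,\Theta)]$; $\mathbb{E}_\Theta$ and $\mathbb{V}_\Theta$ are expectation and variance with respect to $\Theta$ only (conditionally on $\mathcal{D}_n$ and $\mathbf X$). Risks: $R(m_{\infty,n})=\mathbb{E}[m_{\infty,n}(\mathbf X)-m(\mathbf X)]^2$ (expectation over $\mathbf X,\mathcal{D}_n$) and $R(m_{M,n})=\mathbb{E}[m_{M,n}(\mathbf X,\Theta_1,\dots,\Theta_M)-m(\mathbf X)]^2$ (expectation over $\mathbf X,\mathcal{D}_n,\Theta_1,\dots,\Theta_M$). *)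

theory Defs
  imports "HOL-Probability.Probability"
begin

text \<open>\<open>indep_var\<close> requires both random variables to take values in the same type.\<close>

definition indep_rv ::
  "'w measure \<Rightarrow> 'a measure \<Rightarrow> ('w \<Rightarrow> 'a) \<Rightarrow> 'b measure \<Rightarrow> ('w \<Rightarrow> 'b) \<Rightarrow> bool" where
  "indep_rv \<Omega> A U B V \<longleftrightarrow> U \<in> measurable \<Omega> A \<and> V \<in> measurable \<Omega> B \<and>
     prob_space.indep_set \<Omega> {U -` E \<inter> space \<Omega> |E. E \<in> sets A} {V -` F \<inter> space \<Omega> |F. F \<in> sets B}"

definition unit_cube :: "(real ^ 'd) set" where
  "unit_cube = {x. \<forall>j. 0 \<le> x $ j \<and> x $ j \<le> 1}"

abbreviation cube_borel :: "(real ^ 'd) measure" where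
  "cube_borel \<equiv> restrict_space borel unit_cube"

abbreviation obs_space :: "((real ^ 'd) \<times> real) measure" where
  "obs_space \<equiv> cube_borel \<Otimes>\<^sub>M borel"

abbreviation sample_space :: "nat \<Rightarrow> (nat \<Rightarrow> (real ^ 'd) \<times> real) measure" where
  "sample_space n \<equiv> \<Pi>\<^sub>M i\<in>{1..n}. obs_space"

text \<open>The partitions of the unit cube that arise from finitely many successive axis-parallel
  cuts. The points lying on a cutting hyperplane may go to either side of the cut; both sides
  have to be nonempty.\<close>

inductive cut_partition :: "(real ^ 'd) set set \<Rightarrow> bool" where
  root: "cut_partition {unit_cube}"
| cut: "\<lbrakk>cut_partition P; A \<in> P; B = {x\<in>A. x $ j \<le> s} \<or> B = {x\<in>A. x $ j < s};
         B \<noteq> {}; A - B \<noteq> {}\<rbrakk>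
        \<Longrightarrow> cut_partition (insert B (insert (A - B) (P - {A})))"

lemma cut_partition_imp_partition:
  assumes "cut_partition P"
  shows "finite P" and "partition_on unit_cube P"
proof -
  have "finite P \<and> partition_on unit_cube P"
    using assms
  proof induction
    case root
    have "(0 :: real ^ 'd) \<in> unit_cube" by (simp add: unit_cube_def)
    then show ?case by (auto simp: partition_on_def disjoint_def)
  next
    case (cut P A B j s)
    have BA: "B \<subseteq> A" using cut.hyps(3) by auto
    have U: "\<Union>P = unit_cube" and D: "disjoint P" and E: "{} \<notin> P"
      using cut.IH by (auto simp: partition_on_def)
    have "\<Union>(insert B (insert (A - B) (P - {A}))) = \<Union>P"
      using BA \<open>A \<in> P\<close> by blast
    moreover have "disjoint (insert B (insert (A - B) (P - {A})))"
    proof -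
      have "C \<inter> B = {} \<and> C \<inter> (A - B) = {}" if "C \<in> P - {A}" for C
      proof -
        have "C \<inter> A = {}" using D that \<open>A \<in> P\<close> by (auto simp: disjoint_def)
        then show ?thesis using BA by blast
      qed
      moreover have "disjoint (P - {A})"
        using D by (auto intro: pairwise_subset)
      ultimately show ?thesis
        by (fastforce simp: pairwise_insert disjnt_def)
    qed
    ultimately show ?case
      using U E cut.IH cut.hyps(4,5) by (auto simp: partition_on_def)
  qed
  then show "finite P" "partition_on unit_cube P" by auto
qed

definition same_cell :: "'a set set \<Rightarrow> 'a \<Rightarrow> 'a \<Rightarrow> bool" where
  "same_cell P x z \<longleftrightarrow> (\<exists>A\<in>P. x \<in> A \<and> z \<in> A)"

text \<open>In the following definitions \<open>T \<theta> D\<close> is the partition of the tree that is built from the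
  parameter \<open>\<theta>\<close> and the sample \<open>D\<close>, where \<open>D i\<close> is the \<open>i\<close>-th observation, \<open>1 \<le> i \<le> n\<close>.\<close>

definition cell_count ::
  "('t \<Rightarrow> (nat \<Rightarrow> (real ^ 'd) \<times> real) \<Rightarrow> (real ^ 'd) set set) \<Rightarrow> nat
    \<Rightarrow> (nat \<Rightarrow> (real ^ 'd) \<times> real) \<Rightarrow> real ^ 'd \<Rightarrow> 't \<Rightarrow> nat" where
  "cell_count T n D x \<theta> = card {i\<in>{1..n}. same_cell (T \<theta> D) x (fst (D i))}"

definition tree_estimate ::
  "('t \<Rightarrow> (nat \<Rightarrow> (real ^ 'd) \<times> real) \<Rightarrow> (real ^ 'd) set set) \<Rightarrow> nat
    \<Rightarrow> (nat \<Rightarrow> (real ^ 'd) \<times> real) \<Rightarrow> real ^ 'd \<Rightarrow> 't \<Rightarrow> real" where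
  "tree_estimate T n D x \<theta> =
     (\<Sum>i=1..n. snd (D i) * of_bool (same_cell (T \<theta> D) x (fst (D i))))
       / real (cell_count T n D x \<theta>)"

definition finite_forest_estimate ::
  "('t \<Rightarrow> (nat \<Rightarrow> (real ^ 'd) \<times> real) \<Rightarrow> (real ^ 'd) set set) \<Rightarrow> nat
    \<Rightarrow> nat \<Rightarrow> (nat \<Rightarrow> 't) \<Rightarrow> (nat \<Rightarrow> (real ^ 'd) \<times> real) \<Rightarrow> real ^ 'd \<Rightarrow> real" where
  "finite_forest_estimate T n M \<theta> D x =
     (1 / real M) * (\<Sum>k=1..M. tree_estimate T n D x (\<theta> k))"

text \<open>\<open>Q\<close> is the law of the tree parameter. As the parameter is independent of the sample and of
  the query point, expectation and variance with respect to the parameter only, conditionally on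
  the other two, are expectation and variance under \<open>Q\<close> with \<open>D\<close> and \<open>x\<close> held fixed.\<close>

definition infinite_forest_estimate ::
  "('t \<Rightarrow> (nat \<Rightarrow> (real ^ 'd) \<times> real) \<Rightarrow> (real ^ 'd) set set) \<Rightarrow> nat
    \<Rightarrow> 't measure \<Rightarrow> (nat \<Rightarrow> (real ^ 'd) \<times> real) \<Rightarrow> real ^ 'd \<Rightarrow> real" where
  "infinite_forest_estimate T n Q D x = prob_space.expectation Q (tree_estimate T n D x)"

definition tree_variance ::
  "('t \<Rightarrow> (nat \<Rightarrow> (real ^ 'd) \<times> real) \<Rightarrow> (real ^ 'd) set set) \<Rightarrow> nat
    \<Rightarrow> 't measure \<Rightarrow> (nat \<Rightarrow> (real ^ 'd) \<times> real) \<Rightarrow> real ^ 'd \<Rightarrow> real" where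
  "tree_variance T n Q D x = prob_space.variance Q (tree_estimate T n D x)"

definition sample ::
  "nat \<Rightarrow> (nat \<Rightarrow> 'w \<Rightarrow> (real ^ 'd) \<times> real) \<Rightarrow> 'w \<Rightarrow> nat \<Rightarrow> (real ^ 'd) \<times> real" where
  "sample n Z \<omega> = (\<lambda>i\<in>{1..n}. Z i \<omega>)"

definition risk ::
  "'w measure \<Rightarrow> ('w \<Rightarrow> real ^ 'd) \<Rightarrow> (real ^ 'd \<Rightarrow> real) \<Rightarrow> ('w \<Rightarrow> real) \<Rightarrow> real" where
  "risk \<Omega> X m prediction = prob_space.expectation \<Omega> (\<lambda>\<omega>. (prediction \<omega> - m (X \<omega>))\<^sup>2)"

definition regression_function ::
  "'w measure \<Rightarrow> ('w \<Rightarrow> real ^ 'd) \<Rightarrow> ('w \<Rightarrow> real) \<Rightarrow> (real ^ 'd \<Rightarrow> real) \<Rightarrow> bool" where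
  "regression_function \<Omega> X Y m \<longleftrightarrow> m \<in> borel_measurable cube_borel \<and>
     (AE \<omega> in \<Omega>. real_cond_exp \<Omega> (vimage_algebra (space \<Omega>) X cube_borel) Y \<omega> = m (X \<omega>))"

definition sup_norm :: "(real ^ 'd \<Rightarrow> real) \<Rightarrow> real" where
  "sup_norm m = (SUP x\<in>unit_cube. \<bar>m x\<bar>)"

text \<open>The degenerate case \<open>\<sigma> = 0\<close> is included, as the point mass at \<open>0\<close>.\<close>

definition centered_gaussian :: "real \<Rightarrow> real measure" where
  "centered_gaussian \<sigma> =
     (if \<sigma> = 0 then return borel 0 else density lborel (\<lambda>x. ennreal (normal_density 0 \<sigma> x)))"

text \<open>\<open>\<Theta> 0\<close> is the generic tree parameter, and \<open>\<Theta> 1, \<dots>, \<Theta> M\<close> are the parameters of the \<open>M\<close> trees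
  of the finite forest; \<open>Z i\<close> is the \<open>i\<close>-th observation. The law of \<open>(X, Y)\<close> is the common law of
  the observations, and \<open>X\<close> is also the query point, independent of the sample. The tree construction is arbitrary; \<open>tree_measurable\<close> only makes
  the events that the query point and the \<open>i\<close>-th sample point share a cell measurable.\<close>

locale random_forest = prob_space \<Omega> for \<Omega> :: "'w measure" +
  fixes X :: "'w \<Rightarrow> real ^ 'd" and Y :: "'w \<Rightarrow> real"
    and n :: nat and Z :: "nat \<Rightarrow> 'w \<Rightarrow> (real ^ 'd) \<times> real"
    and M :: nat and S :: "'t measure" and \<Theta> :: "nat \<Rightarrow> 'w \<Rightarrow> 't"
    and T :: "'t \<Rightarrow> (nat \<Rightarrow> (real ^ 'd) \<times> real) \<Rightarrow> (real ^ 'd) set set"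
  assumes X_measurable: "X \<in> measurable \<Omega> cube_borel"
    and Y_measurable: "Y \<in> borel_measurable \<Omega>"
    and Y_square_integrable: "integrable \<Omega> (\<lambda>\<omega>. (Y \<omega>)\<^sup>2)"
    and sample_indep: "indep_vars (\<lambda>_. obs_space) Z {1..n}"
    and sample_distr: "\<And>i. i \<in> {1..n} \<Longrightarrow>
          distr \<Omega> obs_space (Z i) = distr \<Omega> obs_space (\<lambda>\<omega>. (X \<omega>, Y \<omega>))"
    and query_indep: "indep_rv \<Omega> cube_borel X (sample_space n) (sample n Z)"
    and param_indep: "indep_vars (\<lambda>_. S) \<Theta> {0..M}"
    and param_distr: "\<And>k. k \<in> {0..M} \<Longrightarrow> distr \<Omega> S (\<Theta> k) = distr \<Omega> S (\<Theta> 0)"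
    and param_indep_data:
          "indep_rv \<Omega> (\<Pi>\<^sub>M k\<in>{0..M}. S) (\<lambda>\<omega>. \<lambda>k\<in>{0..M}. \<Theta> k \<omega>)
             (cube_borel \<Otimes>\<^sub>M sample_space n) (\<lambda>\<omega>. (X \<omega>, sample n Z \<omega>))"
    and tree_partition: "\<And>\<theta> D. \<theta> \<in> space S \<Longrightarrow> D \<in> space (sample_space n) \<Longrightarrow>
          cut_partition (T \<theta> D)"
    and tree_measurable: "\<And>i. i \<in> {1..n} \<Longrightarrow>
          Measurable.pred (cube_borel \<Otimes>\<^sub>M S \<Otimes>\<^sub>M sample_space n)
            (\<lambda>(x, \<theta>, D). same_cell (T \<theta> D) x (fst (D i)))"

end

theory Submission
  imports Defs
begin

text \<open>As the tree parameters are independent of the query point and the sample, the latter may be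
  held fixed; the \<open>M\<close> tree estimates are then independent with a common mean and variance, so the
  mean square error of their average is the squared bias plus \<open>1 / M\<close> times the variance of one
  tree. Integrating over query point and sample gives the identity. For the bound, a tree estimate
  is an average of observations, hence its variance is at most the largest squared observation,
  which is at most \<open>2 \<parallel>m\<parallel>\<^sup>2\<close> plus twice the largest squared noise; the expectation of the latter
  grows like \<open>\<sigma>\<^sup>2 ln n\<close> because \<open>exp (\<epsilon>\<^sup>2 / (4 \<sigma>\<^sup>2))\<close> is integrable.\<close>

section \<open>Independence, product laws and freezing of one variable\<close>

text \<open>Measurable rectangles determine a product of sigma-finite measures, so it is enough that
  the joint law factorizes on them, and there this is the independence of the preimages.\<close>

lemma (in prob_space) indep_rv_distr:
  assumes "indep_rv M A U B V"
  shows "distr M (A \<Otimes>\<^sub>M B) (\<lambda>\<omega>. (U \<omega>, V \<omega>)) = distr M A U \<Otimes>\<^sub>M distr M B V"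
proof -
  have U [measurable]: "U \<in> measurable M A" and V [measurable]: "V \<in> measurable M B"
    and ind: "indep_set {U -` E \<inter> space M |E. E \<in> sets A} {V -` F \<inter> space M |F. F \<in> sets B}"
    using assms by (auto simp: indep_rv_def)
  interpret U: prob_space "distr M A U" by (rule prob_space_distr) fact
  interpret V: prob_space "distr M B V" by (rule prob_space_distr) fact
  show ?thesis
  proof (rule pair_measure_eqI[symmetric])
    fix E F assume E: "E \<in> sets (distr M A U)" and F: "F \<in> sets (distr M B V)"
    have "emeasure (distr M (A \<Otimes>\<^sub>M B) (\<lambda>\<omega>. (U \<omega>, V \<omega>))) (E \<times> F)
        = emeasure M ((U -` E \<inter> space M) \<inter> (V -` F \<inter> space M))"
      using E F by (subst emeasure_distr) (auto intro!: arg_cong[where f = "emeasure M"])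
    also have "\<dots> = emeasure M (U -` E \<inter> space M) * emeasure M (V -` F \<inter> space M)"
    proof -
      have "prob ((U -` E \<inter> space M) \<inter> (V -` F \<inter> space M))
          = prob (U -` E \<inter> space M) * prob (V -` F \<inter> space M)"
        using E F by (intro indep_setD[OF ind]) auto
      then show ?thesis by (simp only: emeasure_eq_measure ennreal_mult measure_nonneg)
    qed
    also have "\<dots> = emeasure (distr M A U) E * emeasure (distr M B V) F"
      using E F by (simp add: emeasure_distr)
    finally show "emeasure (distr M A U) E * emeasure (distr M B V) F
        = emeasure (distr M (A \<Otimes>\<^sub>M B) (\<lambda>\<omega>. (U \<omega>, V \<omega>))) (E \<times> F)" by simp
  qed (auto intro: U.sigma_finite_measure_axioms V.sigma_finite_measure_axioms)
qed

text \<open>Fubini for the joint law. The inner variable \<open>\<omega>'\<close> acts as an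
  independent copy of the randomness in \<open>U\<close> while \<open>V\<close> stays frozen; this
  replaces conditioning on the query point and the sample.\<close>

lemma (in prob_space) expectation_decouple:
  fixes f :: "'b \<times> 'c \<Rightarrow> real"
  assumes ind: "indep_rv M A U B V"
    and f [measurable]: "f \<in> borel_measurable (A \<Otimes>\<^sub>M B)"
    and int: "integrable M (\<lambda>\<omega>. f (U \<omega>, V \<omega>))"
  shows "expectation (\<lambda>\<omega>. f (U \<omega>, V \<omega>)) = expectation (\<lambda>\<omega>. expectation (\<lambda>\<omega>'. f (U \<omega>', V \<omega>)))"
proof -
  have U [measurable]: "U \<in> measurable M A" and V [measurable]: "V \<in> measurable M B"
    using ind by (auto simp: indep_rv_def)
  interpret U: prob_space "distr M A U" by (rule prob_space_distr) fact
  interpret V: prob_space "distr M B V" by (rule prob_space_distr) fact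
  interpret UV: pair_prob_space "distr M A U" "distr M B V" ..
  have "integrable (distr M A U \<Otimes>\<^sub>M distr M B V) f"
    unfolding indep_rv_distr[OF ind, symmetric] using int by (subst integrable_distr_eq) auto
  then have "integral\<^sup>L (distr M A U \<Otimes>\<^sub>M distr M B V) f
      = (\<integral>v. (\<integral>u. f (u, v) \<partial>distr M A U) \<partial>distr M B V)"
    using UV.integral_snd[of "\<lambda>u v. f (u, v)"] by simp
  also have "\<dots> = (\<integral>v. expectation (\<lambda>\<omega>'. f (U \<omega>', v)) \<partial>distr M B V)"
    by (intro Bochner_Integration.integral_cong refl integral_distr) auto
  also have "\<dots> = expectation (\<lambda>\<omega>. expectation (\<lambda>\<omega>'. f (U \<omega>', V \<omega>)))"
    by (intro integral_distr) auto
  finally show ?thesis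
    unfolding indep_rv_distr[OF ind, symmetric] by (subst (asm) integral_distr) auto
qed

section \<open>Mean square error of an average of independent variables\<close>

text \<open>When the square is expanded, independence factorizes the expectation of each
  off-diagonal product, and centering makes it vanish; only the diagonal survives.\<close>

lemma (in prob_space) expectation_sum_indep_power2:
  fixes W :: "'i \<Rightarrow> 'a \<Rightarrow> real"
  assumes ind: "indep_vars (\<lambda>_. borel) W I" and fin: "finite I"
    and sq: "\<And>k. k \<in> I \<Longrightarrow> integrable M (\<lambda>\<omega>. (W k \<omega>)\<^sup>2)"
    and mean: "\<And>k. k \<in> I \<Longrightarrow> expectation (W k) = 0"
  shows "integrable M (\<lambda>\<omega>. (\<Sum>k\<in>I. W k \<omega>)\<^sup>2)"
    and "expectation (\<lambda>\<omega>. (\<Sum>k\<in>I. W k \<omega>)\<^sup>2) = (\<Sum>k\<in>I. expectation (\<lambda>\<omega>. (W k \<omega>)\<^sup>2))"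
proof -
  have meas [measurable]: "W k \<in> borel_measurable M" if "k \<in> I" for k
    using ind that by (auto simp: indep_vars_def2)
  have W: "integrable M (W k)" if "k \<in> I" for k
    using square_integrable_imp_integrable[OF meas[OF that] sq[OF that]] .
  have off: "integrable M (\<lambda>\<omega>. W k \<omega> * W l \<omega>) \<and> expectation (\<lambda>\<omega>. W k \<omega> * W l \<omega>) = 0"
    if "k \<in> I" "l \<in> I" "k \<noteq> l" for k l
  proof -
    have "indep_vars (\<lambda>_. borel) W {k, l}"
      by (rule indep_vars_subset[OF ind]) (use that in auto)
    then have "integrable M (\<lambda>\<omega>. \<Prod>i\<in>{k, l}. W i \<omega>)"
        "expectation (\<lambda>\<omega>. \<Prod>i\<in>{k, l}. W i \<omega>) = (\<Prod>i\<in>{k, l}. expectation (W i))"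
      using W that by (intro indep_vars_integrable indep_vars_lebesgue_integral; fastforce)+
    then show ?thesis using that mean by simp
  qed
  have int: "integrable M (\<lambda>\<omega>. W k \<omega> * W l \<omega>)" if "k \<in> I" "l \<in> I" for k l
    using off[OF that] sq[OF that(1)] by (cases "k = l") (auto simp: power2_eq_square)
  have eq: "(\<Sum>k\<in>I. W k \<omega>)\<^sup>2 = (\<Sum>k\<in>I. \<Sum>l\<in>I. W k \<omega> * W l \<omega>)" for \<omega>
    by (simp add: power2_eq_square sum_product)
  show "integrable M (\<lambda>\<omega>. (\<Sum>k\<in>I. W k \<omega>)\<^sup>2)"
    unfolding eq using int by auto
  have "expectation (\<lambda>\<omega>. (\<Sum>k\<in>I. W k \<omega>)\<^sup>2) = (\<Sum>k\<in>I. \<Sum>l\<in>I. expectation (\<lambda>\<omega>. W k \<omega> * W l \<omega>))"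
    unfolding eq using int by (simp add: Bochner_Integration.integral_sum)
  also have "\<dots> = (\<Sum>k\<in>I. \<Sum>l\<in>I. if l = k then expectation (\<lambda>\<omega>. (W k \<omega>)\<^sup>2) else 0)"
    using off by (intro sum.cong refl) (auto simp: power2_eq_square)
  also have "\<dots> = (\<Sum>k\<in>I. expectation (\<lambda>\<omega>. (W k \<omega>)\<^sup>2))"
    using fin by simp
  finally show "expectation (\<lambda>\<omega>. (\<Sum>k\<in>I. W k \<omega>)\<^sup>2) = (\<Sum>k\<in>I. expectation (\<lambda>\<omega>. (W k \<omega>)\<^sup>2))" .
qed

text \<open>Bias-variance decomposition about an arbitrary target \<open>c\<close>: the common mean
  carries the bias, and averaging divides the common variance by the number of variables.\<close>

lemma (in prob_space) expectation_average_indep_power2: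
  fixes W :: "'i \<Rightarrow> 'a \<Rightarrow> real"
  assumes ind: "indep_vars (\<lambda>_. borel) W I" and fin: "finite I" and ne: "I \<noteq> {}"
    and sq: "\<And>k. k \<in> I \<Longrightarrow> integrable M (\<lambda>\<omega>. (W k \<omega>)\<^sup>2)"
    and mean: "\<And>k. k \<in> I \<Longrightarrow> expectation (W k) = \<mu>"
    and var: "\<And>k. k \<in> I \<Longrightarrow> variance (W k) = v"
  shows "expectation (\<lambda>\<omega>. ((1 / card I) * (\<Sum>k\<in>I. W k \<omega>) - c)\<^sup>2) = (\<mu> - c)\<^sup>2 + v / card I"
proof -
  have meas [measurable]: "W k \<in> borel_measurable M" if "k \<in> I" for k
    using ind that by (auto simp: indep_vars_def2)
  have W: "integrable M (W k)" if "k \<in> I" for k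
    using square_integrable_imp_integrable[OF meas[OF that] sq[OF that]] .
  define A where "A k \<omega> = W k \<omega> - \<mu>" for k \<omega>
  have indA: "indep_vars (\<lambda>_. borel) A I"
    unfolding A_def by (rule indep_vars_compose2[OF ind]) simp
  have A: "integrable M (A k)" "expectation (A k) = 0" "integrable M (\<lambda>\<omega>. (A k \<omega>)\<^sup>2)"
      "expectation (\<lambda>\<omega>. (A k \<omega>)\<^sup>2) = v" if "k \<in> I" for k
    unfolding A_def power2_diff using W[OF that] sq[OF that] mean[OF that] var[OF that]
    by (auto simp: prob_space power2_diff)
  note sumA = expectation_sum_indep_power2[OF indA fin A(3) A(2)]
  define N where "N = real (card I)"
  have N: "N > 0" using fin ne by (simp add: N_def card_gt_0_iff)
  \<comment> \<open>The average minus \<open>c\<close> is \<open>\<mu> - c\<close> plus the average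
    of the centered variables. The mixed term has expectation 0, and the last one contributes
    \<open>N * v / N\<^sup>2\<close>.\<close>
  have eq: "((1 / N) * (\<Sum>k\<in>I. W k \<omega>) - c)\<^sup>2
      = (\<mu> - c)\<^sup>2 + (2 * (\<mu> - c) / N) * (\<Sum>k\<in>I. A k \<omega>) + (1 / N\<^sup>2) * (\<Sum>k\<in>I. A k \<omega>)\<^sup>2" for \<omega>
  proof -
    have "(\<Sum>k\<in>I. W k \<omega>) = (\<Sum>k\<in>I. A k \<omega>) + N * \<mu>"
      by (simp add: A_def sum_subtractf N_def)
    then have "(1 / N) * (\<Sum>k\<in>I. W k \<omega>) - c = (\<mu> - c) + (1 / N) * (\<Sum>k\<in>I. A k \<omega>)"
      using N by (simp add: field_simps)
    then show ?thesis
      by (simp only:) (simp add: power2_eq_square algebra_simps diff_divide_distrib)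
  qed
  have "expectation (\<lambda>\<omega>. ((1 / N) * (\<Sum>k\<in>I. W k \<omega>) - c)\<^sup>2)
      = (\<mu> - c)\<^sup>2 + (2 * (\<mu> - c) / N) * (\<Sum>k\<in>I. expectation (A k))
        + (1 / N\<^sup>2) * expectation (\<lambda>\<omega>. (\<Sum>k\<in>I. A k \<omega>)\<^sup>2)"
    unfolding eq using sumA(1) A(1) by (simp add: prob_space)
  also have "\<dots> = (\<mu> - c)\<^sup>2 + (1 / N\<^sup>2) * (N * v)"
    using A(2,4) by (simp add: sumA(2) N_def)
  finally show ?thesis
    using N by (simp add: N_def power2_eq_square)
qed

section \<open>Control of the largest of several squared Gaussian variables\<close>

text \<open>The exponential factor halves the coefficient of \<open>x\<^sup>2\<close> in the
  exponent, which doubles the variance; \<open>sqrt 2\<close> is the ratio of the normalizing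
  constants. Hence the exponential moment of the squared noise is exactly
  \<open>sqrt 2\<close>.\<close>

lemma normal_density_exp_square:
  assumes "\<sigma> > 0"
  shows "normal_density 0 \<sigma> x * exp (x\<^sup>2 / (4 * \<sigma>\<^sup>2)) = sqrt 2 * normal_density 0 (sqrt 2 * \<sigma>) x"
proof -
  have "exp (- x\<^sup>2 / (2 * \<sigma>\<^sup>2)) * exp (x\<^sup>2 / (4 * \<sigma>\<^sup>2)) = exp (- x\<^sup>2 / (2 * (sqrt 2 * \<sigma>)\<^sup>2))"
    unfolding exp_add[symmetric] using assms
    by (intro arg_cong[where f = exp]) (simp add: power_mult_distrib field_simps)
  moreover have "1 / sqrt (2 * pi * \<sigma>\<^sup>2) = sqrt 2 * (1 / sqrt (2 * pi * (sqrt 2 * \<sigma>)\<^sup>2))"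
    using assms by (simp add: power_mult_distrib real_sqrt_mult field_simps)
  ultimately show ?thesis
    unfolding normal_density_def by (simp only: diff_0_right mult.assoc)
qed

text \<open>A pointwise majorant replaces the usual Jensen argument for the maximum of \<open>n\<close> squared
  Gaussian variables: it gives \<open>max x\<^sub>i\<^sup>2 \<le> c + (\<Sum>i. h x\<^sub>i)\<close>. For \<open>\<sigma> > 0\<close> the inequality
  \<open>u + 1 \<le> exp u\<close> is used at \<open>u = x\<^sup>2 / (4 \<sigma>\<^sup>2) - ln n\<close>.\<close>

lemma centered_gaussian_majorant:
  assumes "\<sigma> \<ge> 0" and n: "n \<ge> (1 :: nat)"
  obtains c and h :: "real \<Rightarrow> real" where
    "\<And>x. x\<^sup>2 \<le> c + h x" and "\<And>x. h x \<ge> 0" and "integrable (centered_gaussian \<sigma>) h"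
    and "c + real n * (\<integral>x. h x \<partial>centered_gaussian \<sigma>) \<le> \<sigma>\<^sup>2 * (2 + 4 * ln (real n))"
proof (cases "\<sigma> = 0")
  case True
  \<comment> \<open>The point mass at 0 gives \<open>x\<^sup>2\<close> integral 0, so
    \<open>c = 0\<close> and \<open>h x = x\<^sup>2\<close> make both sides of the last bound
    0.\<close>
  have "integrable (return borel (0 :: real)) (\<lambda>x. x\<^sup>2)"
    by (auto simp: integrable_iff_bounded nn_integral_return)
  then show ?thesis
    using that[of 0 "\<lambda>x. x\<^sup>2"] True by (simp add: centered_gaussian_def integral_return)
next
  case False
  then have \<sigma>: "\<sigma> > 0" using assms by simp
  \<comment> \<open>The shift by \<open>ln n\<close> puts \<open>1 / n\<close> in front of the
    exponential, so that \<open>n\<close> integrals of \<open>h\<close> add up to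
    \<open>4 * \<sigma>\<^sup>2 * sqrt 2\<close> whatever \<open>n\<close> is; the logarithm is left
    in \<open>c\<close>, which is negative for \<open>n \<le> 2\<close>.\<close>
  define h where "h x = 4 * \<sigma>\<^sup>2 / n * exp (x\<^sup>2 / (4 * \<sigma>\<^sup>2))" for x :: real
  define c where "c = 4 * \<sigma>\<^sup>2 * (ln n - 1)"
  have G: "centered_gaussian \<sigma> = density lborel (\<lambda>x. ennreal (normal_density 0 \<sigma> x))"
    using False by (simp add: centered_gaussian_def)
  have [measurable]: "h \<in> borel_measurable borel" unfolding h_def by measurable
  have eq: "normal_density 0 \<sigma> x * h x
      = (4 * \<sigma>\<^sup>2 / n * sqrt 2) * normal_density 0 (sqrt 2 * \<sigma>) x" for x
    using normal_density_exp_square[OF \<sigma>, of x] by (simp add: h_def mult_ac)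
  show ?thesis
  proof (rule that[of c h])
    fix x :: real
    show "h x \<ge> 0" using n by (simp add: h_def)
    define t where "t = x\<^sup>2 / (4 * \<sigma>\<^sup>2)"
    have "t - ln n + 1 \<le> exp (t - ln n)" using exp_ge_add_one_self[of "t - ln n"] by linarith
    also have "\<dots> = exp t / n" using n by (simp add: exp_diff)
    finally have "4 * \<sigma>\<^sup>2 * t \<le> 4 * \<sigma>\<^sup>2 * (exp t / n + ln n - 1)"
      using \<sigma> by (intro mult_left_mono) auto
    moreover have "4 * \<sigma>\<^sup>2 * t = x\<^sup>2" using \<sigma> by (simp add: t_def)
    ultimately show "x\<^sup>2 \<le> c + h x"
      by (simp add: c_def h_def t_def[symmetric] algebra_simps)
  next
    show "integrable (centered_gaussian \<sigma>) h"
      unfolding G using \<sigma> by (subst integrable_density) (auto simp: eq)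
    have "(\<integral>x. h x \<partial>centered_gaussian \<sigma>) = 4 * \<sigma>\<^sup>2 / n * sqrt 2"
      unfolding G using \<sigma> by (subst integral_density) (auto simp: eq)
    then have "c + n * (\<integral>x. h x \<partial>centered_gaussian \<sigma>) = \<sigma>\<^sup>2 * (4 * ln n - 4 + 4 * sqrt 2)"
      using n by (simp add: c_def algebra_simps)
    \<comment> \<open>This turns the constant \<open>4 * sqrt 2 - 4\<close> into 2.\<close>
    moreover have "sqrt 2 \<le> 3 / 2" by (rule real_le_lsqrt) (auto simp: power2_eq_square)
    ultimately show "c + n * (\<integral>x. h x \<partial>centered_gaussian \<sigma>) \<le> \<sigma>\<^sup>2 * (2 + 4 * ln n)"
      by (auto intro!: mult_left_mono)
  qed
qed

section \<open>Boundedness and measurability of tree estimates\<close>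

text \<open>In an occupied cell the estimate is a weighted mean of observations with weights
  \<open>w i / N\<close>, so its absolute value is at most \<open>sqrt b\<close>.\<close>

lemma tree_estimate_power2_le:
  assumes b: "\<And>i. i \<in> {1..n} \<Longrightarrow> (snd (D i))\<^sup>2 \<le> b" and "b \<ge> 0"
  shows "(tree_estimate T n D x \<theta>)\<^sup>2 \<le> b"
proof -
  define w :: "nat \<Rightarrow> real" where "w i = of_bool (same_cell (T \<theta> D) x (fst (D i)))" for i
  define N where "N = (\<Sum>i=1..n. w i)"
  have N: "real (cell_count T n D x \<theta>) = N"
    by (simp add: cell_count_def N_def w_def sum_of_bool_eq Int_def)
  have w: "w i \<ge> 0" for i by (simp add: w_def)
  have "\<bar>\<Sum>i=1..n. snd (D i) * w i\<bar> \<le> (\<Sum>i=1..n. \<bar>snd (D i) * w i\<bar>)" by (rule sum_abs)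
  also have "\<dots> \<le> (\<Sum>i=1..n. sqrt b * w i)"
    using b by (intro sum_mono) (auto simp: abs_mult w intro!: mult_right_mono real_le_rsqrt)
  also have "\<dots> = sqrt b * N" by (simp add: N_def sum_distrib_left)
  finally have le: "\<bar>\<Sum>i=1..n. snd (D i) * w i\<bar> \<le> sqrt b * N" .
  have "N \<ge> 0" unfolding N_def by (intro sum_nonneg w)
  \<comment> \<open>In an empty cell \<open>N = 0\<close>, and division by zero yields 0, in
    accordance with the convention 0/0 = 0.\<close>
  then have "\<bar>(\<Sum>i=1..n. snd (D i) * w i) / N\<bar> \<le> sqrt b"
    using le \<open>b \<ge> 0\<close> by (cases "N = 0") (auto simp: field_simps)
  then have "\<bar>tree_estimate T n D x \<theta>\<bar> \<le> sqrt b"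
    unfolding tree_estimate_def N w_def .
  then have "\<bar>tree_estimate T n D x \<theta>\<bar>\<^sup>2 \<le> (sqrt b)\<^sup>2" by (rule power_mono) simp
  then show ?thesis using \<open>b \<ge> 0\<close> by simp
qed

context random_forest
begin

text \<open>The tree enters the estimate only through the indicators of sharing a cell with a sample
  point: numerator and denominator are sums over them. Thus \<open>tree_measurable\<close> suffices,
  without a sigma-algebra on the partitions.\<close>

lemma measurable_tree_estimate:
  "(\<lambda>(x, \<theta>, D). tree_estimate T n D x \<theta>) \<in> borel_measurable (cube_borel \<Otimes>\<^sub>M S \<Otimes>\<^sub>M sample_space n)"
proof -
  let ?N = "cube_borel \<Otimes>\<^sub>M S \<Otimes>\<^sub>M sample_space n"
  have w [measurable]: "(\<lambda>p. of_bool (case p of (x, \<theta>, D) \<Rightarrow> same_cell (T \<theta> D) x (fst (D i))) :: real)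
      \<in> borel_measurable ?N" if "i \<in> {1..n}" for i
    using tree_measurable[OF that] by measurable
  have y [measurable]: "(\<lambda>p. snd (snd (snd p) i)) \<in> borel_measurable ?N" if "i \<in> {1..n}" for i
    using that by measurable
  have "(\<lambda>(x, \<theta>, D). tree_estimate T n D x \<theta>) = (\<lambda>p.
      (\<Sum>i=1..n. snd (snd (snd p) i) *
         of_bool (case p of (x, \<theta>, D) \<Rightarrow> same_cell (T \<theta> D) x (fst (D i))))
      / (\<Sum>i=1..n. of_bool (case p of (x, \<theta>, D) \<Rightarrow> same_cell (T \<theta> D) x (fst (D i)))))"
    by (auto simp: fun_eq_iff tree_estimate_def cell_count_def sum_of_bool_eq Int_def)
  also have "\<dots> \<in> borel_measurable ?N"
    by (intro borel_measurable_divide borel_measurable_sum borel_measurable_times w y)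
  finally show ?thesis .
qed

lemma measurable_tree_estimate_compose:
  assumes "x \<in> measurable N cube_borel" "\<theta> \<in> measurable N S" "D \<in> measurable N (sample_space n)"
  shows "(\<lambda>v. tree_estimate T n (D v) (x v) (\<theta> v)) \<in> borel_measurable N"
proof -
  have "(\<lambda>v. (x v, \<theta> v, D v)) \<in> measurable N (cube_borel \<Otimes>\<^sub>M S \<Otimes>\<^sub>M sample_space n)"
    using assms by measurable
  from measurable_compose[OF this measurable_tree_estimate] show ?thesis by simp
qed

lemma tree_estimate_measurable_param:
  assumes "x \<in> space cube_borel" and "D \<in> space (sample_space n)"
  shows "tree_estimate T n D x \<in> borel_measurable S"
  using measurable_tree_estimate_compose[of "\<lambda>_. x" S "\<lambda>\<theta>. \<theta>" "\<lambda>_. D"] assms by simp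

lemma Z_measurable: "i \<in> {1..n} \<Longrightarrow> Z i \<in> measurable \<Omega> obs_space"
  using sample_indep by (auto simp: indep_vars_def2)

lemma sample_measurable: "sample n Z \<in> measurable \<Omega> (sample_space n)"
  using query_indep by (auto simp: indep_rv_def)

lemma param_measurable: "k \<in> {0..M} \<Longrightarrow> \<Theta> k \<in> measurable \<Omega> S"
  using param_indep by (auto simp: indep_vars_def2)

lemma prob_space_param: "prob_space (distr \<Omega> S (\<Theta> 0))"
  by (rule prob_space_distr) (simp add: param_measurable)

text \<open>Equality of laws transports integrals from \<open>(X, Y)\<close>, where the noise is
  given, to the single observations.\<close>

lemma integral_observation:
  fixes f :: "(real ^ 'd) \<times> real \<Rightarrow> real"
  assumes i: "i \<in> {1..n}" and f: "f \<in> borel_measurable obs_space"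
    and int: "integrable \<Omega> (\<lambda>\<omega>. f (X \<omega>, Y \<omega>))"
  shows "integrable \<Omega> (\<lambda>\<omega>. f (Z i \<omega>))"
    and "expectation (\<lambda>\<omega>. f (Z i \<omega>)) = expectation (\<lambda>\<omega>. f (X \<omega>, Y \<omega>))"
proof -
  have XY: "(\<lambda>\<omega>. (X \<omega>, Y \<omega>)) \<in> measurable \<Omega> obs_space"
    using X_measurable Y_measurable by measurable
  show "integrable \<Omega> (\<lambda>\<omega>. f (Z i \<omega>))"
    using integrable_distr_eq[OF Z_measurable[OF i] f] integrable_distr_eq[OF XY f] int
    by (simp add: sample_distr[OF i])
  show "expectation (\<lambda>\<omega>. f (Z i \<omega>)) = expectation (\<lambda>\<omega>. f (X \<omega>, Y \<omega>))"
    using integral_distr[OF Z_measurable[OF i] f] integral_distr[OF XY f]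
    by (simp add: sample_distr[OF i])
qed

lemma integral_param:
  fixes f :: "'t \<Rightarrow> real"
  assumes "k \<in> {0..M}" and f: "f \<in> borel_measurable S"
  shows "expectation (\<lambda>\<omega>. f (\<Theta> k \<omega>)) = (\<integral>\<theta>. f \<theta> \<partial>distr \<Omega> S (\<Theta> 0))"
  using integral_distr[OF param_measurable[OF assms(1)] f] param_distr[OF assms(1)] by simp

section \<open>Conditional statements at a fixed query point and sample\<close>

context
  fixes x :: "real ^ 'd" and D :: "nat \<Rightarrow> (real ^ 'd) \<times> real" and b :: real
  assumes x: "x \<in> space cube_borel" and D: "D \<in> space (sample_space n)"
    and b: "\<And>i. i \<in> {1..n} \<Longrightarrow> (snd (D i))\<^sup>2 \<le> b" "b \<ge> 0"
begin

lemma tree_estimate_power2_bounded: "(tree_estimate T n D x \<theta>)\<^sup>2 \<le> b"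
  by (rule tree_estimate_power2_le) (use b in auto)

lemma tree_estimate_power2_integrable:
  "integrable (distr \<Omega> S (\<Theta> 0)) (\<lambda>\<theta>. (tree_estimate T n D x \<theta>)\<^sup>2)"
proof -
  interpret Q: prob_space "distr \<Omega> S (\<Theta> 0)" by (rule prob_space_param)
  have [measurable]: "tree_estimate T n D x \<in> borel_measurable S"
    using x D by (rule tree_estimate_measurable_param)
  show ?thesis
    using tree_estimate_power2_bounded by (intro Q.integrable_const_bound[of _ b]) auto
qed

lemma tree_variance_eq:
  "tree_variance T n (distr \<Omega> S (\<Theta> 0)) D x
    = (\<integral>\<theta>. (tree_estimate T n D x \<theta>)\<^sup>2 \<partial>distr \<Omega> S (\<Theta> 0))
      - (infinite_forest_estimate T n (distr \<Omega> S (\<Theta> 0)) D x)\<^sup>2"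
proof -
  interpret Q: prob_space "distr \<Omega> S (\<Theta> 0)" by (rule prob_space_param)
  have [measurable]: "tree_estimate T n D x \<in> borel_measurable S"
    using x D by (rule tree_estimate_measurable_param)
  show ?thesis
    unfolding tree_variance_def infinite_forest_estimate_def
    by (intro Q.variance_eq tree_estimate_power2_integrable
        Q.square_integrable_imp_integrable[OF _ tree_estimate_power2_integrable]) simp
qed

lemma tree_variance_nonneg: "tree_variance T n (distr \<Omega> S (\<Theta> 0)) D x \<ge> 0"
  unfolding tree_variance_def by (rule integral_nonneg_AE) simp

lemma integral_tree_estimate_power2_le:
  "(\<integral>\<theta>. (tree_estimate T n D x \<theta>)\<^sup>2 \<partial>distr \<Omega> S (\<Theta> 0)) \<le> b"
proof -
  interpret Q: prob_space "distr \<Omega> S (\<Theta> 0)" by (rule prob_space_param)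
  show ?thesis
    using tree_estimate_power2_integrable tree_estimate_power2_bounded
    by (intro Q.integral_le_const) auto
qed

text \<open>The variance is the second moment minus a square, and the second moment is at most
  \<open>b\<close>.\<close>

lemma tree_variance_le: "tree_variance T n (distr \<Omega> S (\<Theta> 0)) D x \<le> b"
  using tree_variance_eq integral_tree_estimate_power2_le
    zero_le_power2[of "infinite_forest_estimate T n (distr \<Omega> S (\<Theta> 0)) D x"] by linarith

text \<open>The squared mean is at most the second moment, as the variance is nonnegative.\<close>

lemma infinite_forest_estimate_power2_le:
  "(infinite_forest_estimate T n (distr \<Omega> S (\<Theta> 0)) D x)\<^sup>2 \<le> b"
  using tree_variance_eq integral_tree_estimate_power2_le tree_variance_nonneg by linarith

text \<open>With \<open>x\<close> and \<open>D\<close> fixed, the tree estimates are one measurable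
  function applied to independent parameters of law \<open>distr \<Omega> S (\<Theta> 0)\<close>, so
  the decomposition for averages applies.\<close>

lemma expectation_finite_forest_power2:
  assumes "M \<ge> 1"
  shows "expectation (\<lambda>\<omega>. (finite_forest_estimate T n M (\<lambda>k. \<Theta> k \<omega>) D x - c)\<^sup>2)
    = (infinite_forest_estimate T n (distr \<Omega> S (\<Theta> 0)) D x - c)\<^sup>2
      + tree_variance T n (distr \<Omega> S (\<Theta> 0)) D x / real M"
proof -
  define W where "W k \<omega> = tree_estimate T n D x (\<Theta> k \<omega>)" for k \<omega>
  have g [measurable]: "tree_estimate T n D x \<in> borel_measurable S"
    using x D by (rule tree_estimate_measurable_param)
  \<comment> \<open>Index 0 is dropped: \<open>\<Theta> 0\<close> supplies the generic law and is
    not a tree of the forest.\<close>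
  have indW: "indep_vars (\<lambda>_. borel) W {1..M}"
    unfolding W_def by (rule indep_vars_compose2[OF indep_vars_subset[OF param_indep]]) auto
  have "expectation (\<lambda>\<omega>. ((1 / card {1..M}) * (\<Sum>k\<in>{1..M}. W k \<omega>) - c)\<^sup>2)
      = (infinite_forest_estimate T n (distr \<Omega> S (\<Theta> 0)) D x - c)\<^sup>2
        + tree_variance T n (distr \<Omega> S (\<Theta> 0)) D x / card {1..M}"
  proof (rule expectation_average_indep_power2[OF indW])
    fix k assume k: "k \<in> {1..M}"
    then have k': "k \<in> {0..M}" by simp
    note [measurable] = param_measurable[OF k']
    show "integrable \<Omega> (\<lambda>\<omega>. (W k \<omega>)\<^sup>2)"
      unfolding W_def using tree_estimate_power2_bounded
      by (intro integrable_const_bound[of _ b]) auto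
    show mean: "expectation (W k) = infinite_forest_estimate T n (distr \<Omega> S (\<Theta> 0)) D x"
      unfolding W_def infinite_forest_estimate_def by (rule integral_param[OF k' g])
    show "variance (W k) = tree_variance T n (distr \<Omega> S (\<Theta> 0)) D x"
      unfolding mean unfolding W_def tree_variance_def infinite_forest_estimate_def
      by (rule integral_param[OF k']) measurable
  qed (use assms in auto)
  then show ?thesis by (simp add: finite_forest_estimate_def W_def)
qed

end

section \<open>The risk identity: integration over query point and sample\<close>

text \<open>The conditional bias-variance identity, with target \<open>m (X \<omega>)\<close>, is
  integrated over the data. The integrability claims make the splitting of the expectation
  legitimate.\<close>

lemma forest_risk:
  assumes M: "M \<ge> 1" and m [measurable]: "m \<in> borel_measurable cube_borel"
    and mX: "integrable \<Omega> (\<lambda>\<omega>. (m (X \<omega>))\<^sup>2)"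
  defines "Q \<equiv> distr \<Omega> S (\<Theta> 0)"
  defines "m_M \<equiv> (\<lambda>\<omega>. finite_forest_estimate T n M (\<lambda>k. \<Theta> k \<omega>) (sample n Z \<omega>) (X \<omega>))"
    and "m_inf \<equiv> (\<lambda>\<omega>. infinite_forest_estimate T n Q (sample n Z \<omega>) (X \<omega>))"
    and "V \<equiv> (\<lambda>\<omega>. tree_variance T n Q (sample n Z \<omega>) (X \<omega>))"
  shows "integrable \<Omega> (\<lambda>\<omega>. (m_M \<omega> - m (X \<omega>))\<^sup>2)"
    and "integrable \<Omega> (\<lambda>\<omega>. (m_inf \<omega> - m (X \<omega>))\<^sup>2)"
    and "integrable \<Omega> V"
    and "risk \<Omega> X m m_M = risk \<Omega> X m m_inf + (1 / real M) * expectation V"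
proof -
  note [measurable] = X_measurable sample_measurable
  have Theta [measurable]: "\<Theta> k \<in> measurable \<Omega> S" if "k \<in> {0..M}" for k
    using that by (rule param_measurable)
  interpret Q: prob_space Q unfolding Q_def by (rule prob_space_param)
  have setsQ [measurable_cong]: "sets Q = sets S" by (simp add: Q_def)
  \<comment> \<open>The sum of squared observations is a crude bound on the largest one, but it is
    integrable because \<open>Y\<close> is square integrable; it serves as the dominating function
    throughout.\<close>
  define B where "B D = (\<Sum>i=1..n. (snd (D i :: (real ^ 'd) \<times> real))\<^sup>2)" for D
  have B0: "B D \<ge> 0" for D unfolding B_def by (intro sum_nonneg) simp
  have Bi: "(snd (D i))\<^sup>2 \<le> B D" if "i \<in> {1..n}" for i D
    unfolding B_def using that by (intro member_le_sum) auto
  have "integrable \<Omega> (\<lambda>\<omega>. (snd (Z i \<omega>))\<^sup>2)" if "i \<in> {1..n}" for i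
    by (rule integral_observation(1)[OF that, of "\<lambda>z. (snd z)\<^sup>2"])
      (use Y_square_integrable in simp_all)
  then have intB: "integrable \<Omega> (\<lambda>\<omega>. B (sample n Z \<omega>))"
    unfolding B_def sample_def by (auto intro!: Bochner_Integration.integrable_sum)
  have XD: "X \<omega> \<in> space cube_borel" "sample n Z \<omega> \<in> space (sample_space n)" if "\<omega> \<in> space \<Omega>" for \<omega>
    using measurable_space[OF X_measurable that] measurable_space[OF sample_measurable that] by auto
  have inf_le: "(m_inf \<omega>)\<^sup>2 \<le> B (sample n Z \<omega>)" if "\<omega> \<in> space \<Omega>" for \<omega>
    unfolding m_inf_def Q_def
    by (rule infinite_forest_estimate_power2_le[OF XD[OF that]]) (rule Bi B0, assumption?)+
  have V_bounds: "0 \<le> V \<omega>" "V \<omega> \<le> B (sample n Z \<omega>)" if "\<omega> \<in> space \<Omega>" for \<omega>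
    unfolding V_def Q_def using XD[OF that] Bi B0
    by (blast intro: tree_variance_nonneg, blast intro: tree_variance_le)
  have dom: "integrable \<Omega> (\<lambda>\<omega>. 2 * B (sample n Z \<omega>) + 2 * (m (X \<omega>))\<^sup>2)"
    using intB mX by simp
  have sq: "(u - v)\<^sup>2 \<le> 2 * w + 2 * v\<^sup>2" if "u\<^sup>2 \<le> w" for u v w :: real
    using that sum_squares_bound[of u "- v"] by (simp add: power2_diff)
  have tree_meas [measurable]:
      "(\<lambda>v. tree_estimate T n (sample n Z (fst v)) (X (fst v)) (snd v)) \<in> borel_measurable (\<Omega> \<Otimes>\<^sub>M Q)"
    by (rule measurable_tree_estimate_compose) measurable
  have meas_inf [measurable]: "m_inf \<in> borel_measurable \<Omega>"
    unfolding m_inf_def infinite_forest_estimate_def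
    by (intro Q.borel_measurable_lebesgue_integral) (simp add: case_prod_beta tree_meas)
  \<comment> \<open>Folding the centering term back into the infinite forest estimate reduces the
    integrand to functions already known to be measurable.\<close>
  have meas_V [measurable]: "V \<in> borel_measurable \<Omega>"
    unfolding V_def tree_variance_def infinite_forest_estimate_def[symmetric]
    using meas_inf[unfolded m_inf_def]
    by (intro Q.borel_measurable_lebesgue_integral) (simp add: case_prod_beta)
  have meas_M [measurable]: "m_M \<in> borel_measurable \<Omega>"
    unfolding m_M_def finite_forest_estimate_def
    by (intro borel_measurable_times borel_measurable_sum measurable_tree_estimate_compose
        X_measurable sample_measurable) auto
  have avg: "(finite_forest_estimate T n M \<theta> D x)\<^sup>2 \<le> B D" for \<theta> D x
  proof -
    have "\<bar>\<Sum>k=1..M. tree_estimate T n D x (\<theta> k)\<bar> \<le> (\<Sum>k=1..M. sqrt (B D))"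
      by (intro order.trans[OF sum_abs] sum_mono real_le_rsqrt)
        (unfold power2_abs, rule tree_estimate_power2_le[OF _ B0], rule Bi)
    then have "\<bar>finite_forest_estimate T n M \<theta> D x\<bar> \<le> sqrt (B D)"
      using M by (simp add: finite_forest_estimate_def field_simps)
    then have "\<bar>finite_forest_estimate T n M \<theta> D x\<bar>\<^sup>2 \<le> (sqrt (B D))\<^sup>2" by (rule power_mono) simp
    then show ?thesis using B0 by simp
  qed
  show int_M: "integrable \<Omega> (\<lambda>\<omega>. (m_M \<omega> - m (X \<omega>))\<^sup>2)"
  proof (rule Bochner_Integration.integrable_bound[OF dom])
    show "AE \<omega> in \<Omega>. norm ((m_M \<omega> - m (X \<omega>))\<^sup>2)
        \<le> norm (2 * B (sample n Z \<omega>) + 2 * (m (X \<omega>))\<^sup>2)"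
      using sq[OF avg] B0 unfolding m_M_def by (intro AE_I2) simp
  qed measurable
  show int_inf: "integrable \<Omega> (\<lambda>\<omega>. (m_inf \<omega> - m (X \<omega>))\<^sup>2)"
  proof (rule Bochner_Integration.integrable_bound[OF dom])
    show "AE \<omega> in \<Omega>. norm ((m_inf \<omega> - m (X \<omega>))\<^sup>2)
        \<le> norm (2 * B (sample n Z \<omega>) + 2 * (m (X \<omega>))\<^sup>2)"
      using sq[OF inf_le] B0 by (intro AE_I2) simp
  qed measurable
  show int_V: "integrable \<Omega> V"
  proof (rule Bochner_Integration.integrable_bound[OF intB])
    show "AE \<omega> in \<Omega>. norm (V \<omega>) \<le> norm (B (sample n Z \<omega>))"
      using V_bounds B0 by (intro AE_I2) simp
  qed measurable
  \<comment> \<open>The error is written as a function of the parameter tuple and the data, the two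
    independent blocks of \<open>param_indep_data\<close>. Restricting the tuple to
    \<open>{0..M}\<close> changes nothing, since the forest reads only the indices 1 to
    \<open>M\<close>.\<close>
  define f where "f = (\<lambda>(\<theta>, x, D). (finite_forest_estimate T n M \<theta> D x - m x)\<^sup>2)"
  have f_Theta: "f (\<lambda>k\<in>{0..M}. \<Theta> k \<omega>', X \<omega>, sample n Z \<omega>)
      = (finite_forest_estimate T n M (\<lambda>k. \<Theta> k \<omega>') (sample n Z \<omega>) (X \<omega>) - m (X \<omega>))\<^sup>2" for \<omega> \<omega>'
    by (simp add: f_def finite_forest_estimate_def)
  have "risk \<Omega> X m m_M = expectation (\<lambda>\<omega>. f (\<lambda>k\<in>{0..M}. \<Theta> k \<omega>, X \<omega>, sample n Z \<omega>))"
    unfolding risk_def m_M_def f_Theta ..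
  also have "\<dots> = expectation (\<lambda>\<omega>. expectation (\<lambda>\<omega>'. f (\<lambda>k\<in>{0..M}. \<Theta> k \<omega>', X \<omega>, sample n Z \<omega>)))"
  proof (rule expectation_decouple[OF param_indep_data])
    show "integrable \<Omega> (\<lambda>\<omega>. f (\<lambda>k\<in>{0..M}. \<Theta> k \<omega>, X \<omega>, sample n Z \<omega>))"
      using int_M unfolding f_Theta m_M_def .
    have [measurable]: "(\<lambda>v. fst v k) \<in> measurable
        ((\<Pi>\<^sub>M k\<in>{0..M}. S) \<Otimes>\<^sub>M (cube_borel \<Otimes>\<^sub>M sample_space n)) S" if "k \<in> {1..M}" for k
      by (rule measurable_compose[OF measurable_fst measurable_component_singleton]) (use that in simp)
    show "f \<in> borel_measurable ((\<Pi>\<^sub>M k\<in>{0..M}. S) \<Otimes>\<^sub>M (cube_borel \<Otimes>\<^sub>M sample_space n))"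
      unfolding f_def finite_forest_estimate_def case_prod_beta
      by (intro borel_measurable_power borel_measurable_diff borel_measurable_times
          borel_measurable_sum measurable_tree_estimate_compose) auto
  qed
  also have "\<dots> = expectation (\<lambda>\<omega>. (m_inf \<omega> - m (X \<omega>))\<^sup>2 + V \<omega> / real M)"
    unfolding f_Theta m_inf_def V_def Q_def
    by (intro Bochner_Integration.integral_cong refl expectation_finite_forest_power2 XD)
      (use Bi B0 M in auto)
  also have "\<dots> = risk \<Omega> X m m_inf + (1 / real M) * expectation V"
    using int_inf int_V by (simp add: risk_def)
  finally show "risk \<Omega> X m m_M = risk \<Omega> X m m_inf + (1 / real M) * expectation V" .
qed

section \<open>Bounding the expected variance of one tree\<close>

text \<open>Pathwise, the variance is at most the largest squared observation, hence at most
  \<open>2 * s\<^sup>2\<close> plus twice the largest squared residual. The Gaussian majorant bounds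
  the latter by a sum whose expectation is computable term by term.\<close>

lemma expectation_tree_variance_le:
  assumes n: "n \<ge> 1" and m [measurable]: "m \<in> borel_measurable cube_borel"
    and s: "\<And>x. x \<in> unit_cube \<Longrightarrow> \<bar>m x\<bar> \<le> s"
    and Y: "\<And>\<omega>. \<omega> \<in> space \<Omega> \<Longrightarrow> Y \<omega> = m (X \<omega>) + \<epsilon> \<omega>"
    and eps [measurable]: "\<epsilon> \<in> borel_measurable \<Omega>"
    and \<sigma>: "\<sigma> \<ge> 0" and gauss: "distr \<Omega> borel \<epsilon> = centered_gaussian \<sigma>"
    and int: "integrable \<Omega> (\<lambda>\<omega>. tree_variance T n (distr \<Omega> S (\<Theta> 0)) (sample n Z \<omega>) (X \<omega>))"
  shows "expectation (\<lambda>\<omega>. tree_variance T n (distr \<Omega> S (\<Theta> 0)) (sample n Z \<omega>) (X \<omega>))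
    \<le> 2 * s\<^sup>2 + \<sigma>\<^sup>2 * (4 + 8 * ln (real n))"
proof -
  note [measurable] = X_measurable
  obtain c h where h: "\<And>x. x\<^sup>2 \<le> c + h x" "\<And>x. h x \<ge> 0"
    and inth: "integrable (centered_gaussian \<sigma>) h"
    and c: "c + real n * (\<integral>x. h x \<partial>centered_gaussian \<sigma>) \<le> \<sigma>\<^sup>2 * (2 + 4 * ln (real n))"
    using centered_gaussian_majorant[OF \<sigma> n] by blast
  have setsG: "sets (centered_gaussian \<sigma>) = sets borel"
    using gauss by (metis sets_distr)
  have hm [measurable]: "h \<in> borel_measurable borel"
    using borel_measurable_integrable[OF inth] measurable_cong_sets[OF setsG refl] by auto
  \<comment> \<open>The noise \<open>\<epsilon>\<close> belongs to \<open>(X, Y)\<close> only.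
    Writing it as the residual of an observation lets equality of laws carry its integral over to
    every \<open>Z i\<close>.\<close>
  define \<phi> where "\<phi> z = h (snd z - m (fst z))" for z
  have \<phi>m [measurable]: "\<phi> \<in> borel_measurable obs_space" unfolding \<phi>_def by measurable
  have \<phi>XY: "\<phi> (X \<omega>, Y \<omega>) = h (\<epsilon> \<omega>)" if "\<omega> \<in> space \<Omega>" for \<omega>
    using Y[OF that] by (simp add: \<phi>_def)
  have "integrable \<Omega> (\<lambda>\<omega>. h (\<epsilon> \<omega>))" "expectation (\<lambda>\<omega>. h (\<epsilon> \<omega>)) = (\<integral>x. h x \<partial>centered_gaussian \<sigma>)"
    using inth unfolding gauss[symmetric] by (simp_all add: integrable_distr_eq integral_distr)
  then have XY: "integrable \<Omega> (\<lambda>\<omega>. \<phi> (X \<omega>, Y \<omega>))"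
      "expectation (\<lambda>\<omega>. \<phi> (X \<omega>, Y \<omega>)) = (\<integral>x. h x \<partial>centered_gaussian \<sigma>)"
    using \<phi>XY by (simp_all cong: Bochner_Integration.integrable_cong Bochner_Integration.integral_cong)
  note Zi = integral_observation[OF _ \<phi>m XY(1)]
  \<comment> \<open>The constant \<open>c\<close> stands outside the sum and is counted once, which
    keeps the bound logarithmic in \<open>n\<close>; only the terms
    \<open>\<phi> (Z i \<omega>)\<close> are summed.\<close>
  define b where "b \<omega> = 2 * s\<^sup>2 + 2 * (c + (\<Sum>i=1..n. \<phi> (Z i \<omega>)))" for \<omega>
  have le: "(snd (sample n Z \<omega> i))\<^sup>2 \<le> b \<omega>" if "\<omega> \<in> space \<Omega>" "i \<in> {1..n}" for \<omega> i
  proof -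
    have "fst (Z i \<omega>) \<in> unit_cube"
      using measurable_space[OF Z_measurable[OF that(2)] that(1)]
      by (auto simp: space_pair_measure space_restrict_space)
    then have "\<bar>m (fst (Z i \<omega>))\<bar>\<^sup>2 \<le> s\<^sup>2"
      by (intro power_mono s) simp_all
    moreover have "(snd (Z i \<omega>) - m (fst (Z i \<omega>)))\<^sup>2 \<le> c + \<phi> (Z i \<omega>)"
      unfolding \<phi>_def by (rule h)
    moreover have "\<phi> (Z i \<omega>) \<le> (\<Sum>i=1..n. \<phi> (Z i \<omega>))"
      using that h(2) by (intro member_le_sum) (auto simp: \<phi>_def)
    \<comment> \<open>The difference of the two sides is the square of
      \<open>snd (Z i \<omega>) - 2 * m (fst (Z i \<omega>))\<close>.\<close>
    moreover have "(snd (Z i \<omega>))\<^sup>2 \<le> 2 * (m (fst (Z i \<omega>)))\<^sup>2 + 2 * (snd (Z i \<omega>) - m (fst (Z i \<omega>)))\<^sup>2"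
      using zero_le_power2[of "snd (Z i \<omega>) - 2 * m (fst (Z i \<omega>))"]
      by (simp add: power2_eq_square algebra_simps)
    ultimately show ?thesis
      using that by (simp add: sample_def b_def)
  qed
  \<comment> \<open>As \<open>c\<close> can be negative, nonnegativity is read off from the
    domination of the first squared observation, which exists because
    \<open>n \<ge> 1\<close>.\<close>
  have b0: "b \<omega> \<ge> 0" if "\<omega> \<in> space \<Omega>" for \<omega>
    using order.trans[OF zero_le_power2 le[OF that, of 1]] n by simp
  have intS: "integrable \<Omega> (\<lambda>\<omega>. \<Sum>i=1..n. \<phi> (Z i \<omega>))"
    by (intro Bochner_Integration.integrable_sum Zi(1))
  have "expectation (\<lambda>\<omega>. \<Sum>i=1..n. \<phi> (Z i \<omega>)) = (\<Sum>i=1..n. expectation (\<lambda>\<omega>. \<phi> (Z i \<omega>)))"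
    by (intro Bochner_Integration.integral_sum Zi(1))
  also have "\<dots> = real n * (\<integral>x. h x \<partial>centered_gaussian \<sigma>)" using Zi(2) XY(2) by simp
  finally have ES: "expectation (\<lambda>\<omega>. \<Sum>i=1..n. \<phi> (Z i \<omega>)) = real n * (\<integral>x. h x \<partial>centered_gaussian \<sigma>)" .
  have intb: "integrable \<Omega> b" unfolding b_def using intS by simp
  have "expectation (\<lambda>\<omega>. tree_variance T n (distr \<Omega> S (\<Theta> 0)) (sample n Z \<omega>) (X \<omega>)) \<le> expectation b"
    using int intb
  proof (rule integral_mono)
    fix \<omega> assume \<omega>: "\<omega> \<in> space \<Omega>"
    show "tree_variance T n (distr \<Omega> S (\<Theta> 0)) (sample n Z \<omega>) (X \<omega>) \<le> b \<omega>"
      using measurable_space[OF X_measurable \<omega>] measurable_space[OF sample_measurable \<omega>] le[OF \<omega>] b0[OF \<omega>]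
      by (rule tree_variance_le)
  qed
  also have "expectation b = 2 * s\<^sup>2 + 2 * (c + real n * (\<integral>x. h x \<partial>centered_gaussian \<sigma>))"
    unfolding b_def using intS ES by (simp add: prob_space)
  also have "\<dots> \<le> 2 * s\<^sup>2 + \<sigma>\<^sup>2 * (4 + 8 * ln (real n))"
    using c by (simp add: algebra_simps)
  finally show ?thesis .
qed

end

section \<open>Combination of the risk identity and the variance bound\<close>

theorem theorem3p3:
  fixes \<Omega> :: "'w measure" and X :: "'w \<Rightarrow> real ^ 'd" and Y \<epsilon> :: "'w \<Rightarrow> real"
    and n M :: nat and Z :: "nat \<Rightarrow> 'w \<Rightarrow> (real ^ 'd) \<times> real"
    and S :: "'t measure" and \<Theta> :: "nat \<Rightarrow> 'w \<Rightarrow> 't"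
    and T :: "'t \<Rightarrow> (nat \<Rightarrow> (real ^ 'd) \<times> real) \<Rightarrow> (real ^ 'd) set set"
    and m :: "real ^ 'd \<Rightarrow> real" and \<sigma> :: real
  assumes "random_forest \<Omega> X Y n Z M S \<Theta> T"
    and "n \<ge> 1" and "M \<ge> 1"
    and "regression_function \<Omega> X Y m"
    and "\<And>\<omega>. \<omega> \<in> space \<Omega> \<Longrightarrow> Y \<omega> = m (X \<omega>) + \<epsilon> \<omega>"
    and "\<epsilon> \<in> borel_measurable \<Omega>"
    and "\<sigma> \<ge> 0" and "distr \<Omega> borel \<epsilon> = centered_gaussian \<sigma>"
    and "indep_rv \<Omega> cube_borel X borel \<epsilon>"
    and "bdd_above ((\<lambda>x. \<bar>m x\<bar>) ` unit_cube)"
  shows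
    "let Q = distr \<Omega> S (\<Theta> 0);
         m_M = (\<lambda>\<omega>. finite_forest_estimate T n M (\<lambda>k. \<Theta> k \<omega>) (sample n Z \<omega>) (X \<omega>));
         m_inf = (\<lambda>\<omega>. infinite_forest_estimate T n Q (sample n Z \<omega>) (X \<omega>));
         V = (\<lambda>\<omega>. tree_variance T n Q (sample n Z \<omega>) (X \<omega>))
     in integrable \<Omega> (\<lambda>\<omega>. (m_M \<omega> - m (X \<omega>))\<^sup>2)
      \<and> integrable \<Omega> (\<lambda>\<omega>. (m_inf \<omega> - m (X \<omega>))\<^sup>2)
      \<and> integrable \<Omega> V
      \<and> risk \<Omega> X m m_M = risk \<Omega> X m m_inf + (1 / real M) * prob_space.expectation \<Omega> V
      \<and> 0 \<le> risk \<Omega> X m m_M - risk \<Omega> X m m_inf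
      \<and> risk \<Omega> X m m_M - risk \<Omega> X m m_inf
          \<le> (8 / real M) * ((sup_norm m)\<^sup>2 + \<sigma>\<^sup>2 * (1 + 4 * ln (real n)))"
proof -
  interpret random_forest \<Omega> X Y n Z M S \<Theta> T by fact
  note [measurable] = X_measurable
  have m [measurable]: "m \<in> borel_measurable cube_borel"
    using assms(4) by (simp add: regression_function_def)
  have s: "\<bar>m x\<bar> \<le> sup_norm m" if "x \<in> unit_cube" for x
    unfolding sup_norm_def using that assms(10) by (rule cSUP_upper)
  have X: "X \<omega> \<in> unit_cube" if "\<omega> \<in> space \<Omega>" for \<omega>
    using measurable_space[OF X_measurable that] by (simp add: space_restrict_space)
  have "integrable \<Omega> (\<lambda>\<omega>. (m (X \<omega>))\<^sup>2)"
  proof (rule integrable_const_bound)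
    show "AE \<omega> in \<Omega>. norm ((m (X \<omega>))\<^sup>2) \<le> (sup_norm m)\<^sup>2"
      using power_mono[OF s[OF X] abs_ge_zero, where n = 2] by (intro AE_I2) simp
  qed measurable
  note risk = forest_risk[OF assms(3) m this]
  let ?V = "\<lambda>\<omega>. tree_variance T n (distr \<Omega> S (\<Theta> 0)) (sample n Z \<omega>) (X \<omega>)"
  have V0: "expectation ?V \<ge> 0"
    unfolding tree_variance_def by (intro integral_nonneg_AE AE_I2) simp
  have "expectation ?V \<le> 2 * (sup_norm m)\<^sup>2 + \<sigma>\<^sup>2 * (4 + 8 * ln (real n))"
    by (rule expectation_tree_variance_le[OF assms(2) m s assms(5-8) risk(3)])
  \<comment> \<open>Since \<open>ln n \<ge> 0\<close>, the constants 2, 4 and 8 obtained so far lie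
    below 8, 8 and 32.\<close>
  also have "\<dots> \<le> 8 * ((sup_norm m)\<^sup>2 + \<sigma>\<^sup>2 * (1 + 4 * ln (real n)))"
  proof -
    have "\<sigma>\<^sup>2 * (4 + 8 * ln (real n)) \<le> \<sigma>\<^sup>2 * (8 * (1 + 4 * ln (real n)))"
      using assms(2) by (intro mult_left_mono) simp_all
    then show ?thesis using zero_le_power2[of "sup_norm m"]
      unfolding distrib_left by linarith
  qed
  finally have "(1 / real M) * expectation ?V
      \<le> (1 / real M) * (8 * ((sup_norm m)\<^sup>2 + \<sigma>\<^sup>2 * (1 + 4 * ln (real n))))"
    by (rule mult_left_mono) simp
  then show ?thesis
    using risk V0 by (simp add: Let_def)
qed

end
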